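(* Let $(X,d_1)$ and $(Y,d_2)$ be metric spaces, and let $(X,\mathcal{F})$ and $(Y,\mathcal{G})$ be non-autonomous dynamical systems, where $\mathcal{F}=\{f_n\}_{n\ge0}$ and $\mathcal{G}=\{g_n\}_{n\ge0}$ are sequences of continuous onto maps $f_n:X\to X$ and $g_n:Y\to Y$. Then $\mathcal{F}$ and $\mathcal{G}$ both have the $s$-limit shadowing property if and only if $\mathcal{F}\times\mathcal{G}$ has the $s$-limit shadowing property.
   Context: The product $X\times Y$ carries the metric $d((x_1,y_1),(x_2,y_2))=\max\{d_1(x_1,x_2),d_2(y_1,y_2)\}$. $\mathcal{F}\times\mathcal{G}=\{f_n\times g_n\}_{n\ge0}$, where $(f_n\times g_n)(x,y)=(f_n(x),g_n(y))$. For a sequence $\mathcal{H}=\{h_n\}_{n\ge0}$ of self-maps of a metric space $(Z,\rho)$ put $H_n=h_{n-1}\circ\cdots\circ h_1\circ h_0$ for $n\ge1$ and $H_0=\mathrm{id}$. A sequence $\{x_n\}_{n\ge0}$ in $Z$ is a $\delta$-pseudo-orbit of $\mathcal{H}$ if $\rho(h_n(x_n),x_{n+1})<\delta$ for all $n\ge0$, and a limit pseudo-orbit of $\mathcal{H}$ if $\lim_{n\to\infty}\rho(h_n(x_n),x_{n+1})=0$. A point $y\in Z$ $\varepsilon$-shadows $\{x_n\}$ if $\rho(H_n(y),x_n)<\varepsilon$ for all $n\ge0$, and limit shadows $\{x_n\}$ if $\lim_{n\to\infty}\rho(H_n(y),x_n)=0$. $\mathcal{H}$ has the $s$-limit shadowing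 property (on the whole space $Z$) if for every $\varepsilon>0$ there exists $\delta>0$ such that: (i) for every $\delta$-pseudo-orbit $\{x_n\}_{n\ge0}$ in $Z$ there exists $y\in Z$ that $\varepsilon$-shadows $\{x_n\}_{n\ge0}$; and (ii) for every limit pseudo-orbit $\{x_n\}_{n\ge0}$ in $Z$ there exists $y\in Z$ that limit shadows $\{x_n\}_{n\ge0}$. *)

theory Defs
  imports "HOL-Analysis.Analysis"
begin

text \<open>A metric space is given by an explicit carrier and distance function, as in the locale
  \<^locale>\<open>Metric_space\<close>. The metric instance for product types and \<open>prod_dist\<close> are Euclidean
  (square root of the sum of squares), so the maximum metric is defined here.\<close>

definition max_dist :: "('a \<Rightarrow> 'a \<Rightarrow> real) \<Rightarrow> ('b \<Rightarrow> 'b \<Rightarrow> real) \<Rightarrow> 'a \<times> 'b \<Rightarrow> 'a \<times> 'b \<Rightarrow> real"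
  where "max_dist d1 d2 p q = max (d1 (fst p) (fst q)) (d2 (snd p) (snd q))"

lemma Metric_space_max_dist:
  assumes "Metric_space X d1" and "Metric_space Y d2"
  shows "Metric_space (X \<times> Y) (max_dist d1 d2)"
proof -
  interpret X: Metric_space X d1 by fact
  interpret Y: Metric_space Y d2 by fact
  show ?thesis
  proof
    fix p q :: "'a \<times> 'b"
    show "0 \<le> max_dist d1 d2 p q"
      by (simp add: max_dist_def le_max_iff_disj)
    show "max_dist d1 d2 p q = max_dist d1 d2 q p"
      by (simp add: max_dist_def X.commute Y.commute)
  next
    fix p q assume "p \<in> X \<times> Y" "q \<in> X \<times> Y"
    then have "d1 (fst p) (fst q) = 0 \<longleftrightarrow> fst p = fst q" "d2 (snd p) (snd q) = 0 \<longleftrightarrow> snd p = snd q"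
      by (auto simp: mem_Times_iff)
    moreover have "max_dist d1 d2 p q = 0 \<longleftrightarrow> d1 (fst p) (fst q) = 0 \<and> d2 (snd p) (snd q) = 0"
      using X.nonneg[of "fst p" "fst q"] Y.nonneg[of "snd p" "snd q"]
      unfolding max_dist_def by linarith
    ultimately show "(max_dist d1 d2 p q = 0) = (p = q)"
      by (simp add: prod_eq_iff)
  next
    fix p q r assume "p \<in> X \<times> Y" "q \<in> X \<times> Y" "r \<in> X \<times> Y"
    then show "max_dist d1 d2 p r \<le> max_dist d1 d2 p q + max_dist d1 d2 q r"
      using X.triangle[of "fst p" "fst q" "fst r"] Y.triangle[of "snd p" "snd q" "snd r"]
      by (auto simp: max_dist_def mem_Times_iff)
  qed
qed

text \<open>The phase space is required to be nonempty: if \<open>X\<close> were empty, then every sequence of maps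
  on \<open>X \<times> Y\<close> would have all shadowing properties vacuously, whatever happens on \<open>Y\<close>.\<close>

definition nonautonomous_system :: "'a set \<Rightarrow> ('a \<Rightarrow> 'a \<Rightarrow> real) \<Rightarrow> (nat \<Rightarrow> 'a \<Rightarrow> 'a) \<Rightarrow> bool"
  where "nonautonomous_system Z \<rho> h \<longleftrightarrow>
    Metric_space Z \<rho> \<and> Z \<noteq> {} \<and>
    (\<forall>n. continuous_map (Metric_space.mtopology Z \<rho>) (Metric_space.mtopology Z \<rho>) (h n) \<and>
         h n ` Z = Z)"

definition prod_seq ::
  "(nat \<Rightarrow> 'a \<Rightarrow> 'a) \<Rightarrow> (nat \<Rightarrow> 'b \<Rightarrow> 'b) \<Rightarrow> nat \<Rightarrow> 'a \<times> 'b \<Rightarrow> 'a \<times> 'b"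
  where "prod_seq f g n = map_prod (f n) (g n)"

primrec iter_seq :: "(nat \<Rightarrow> 'a \<Rightarrow> 'a) \<Rightarrow> nat \<Rightarrow> 'a \<Rightarrow> 'a"
  where
    "iter_seq h 0 = id"
  | "iter_seq h (Suc n) = h n \<circ> iter_seq h n"

definition pseudo_orbit ::
  "'a set \<Rightarrow> ('a \<Rightarrow> 'a \<Rightarrow> real) \<Rightarrow> (nat \<Rightarrow> 'a \<Rightarrow> 'a) \<Rightarrow> real \<Rightarrow> (nat \<Rightarrow> 'a) \<Rightarrow> bool"
  where "pseudo_orbit Z \<rho> h \<delta> x \<longleftrightarrow>
    (\<forall>n. x n \<in> Z) \<and> (\<forall>n. \<rho> (h n (x n)) (x (Suc n)) < \<delta>)"

definition limit_pseudo_orbit ::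
  "'a set \<Rightarrow> ('a \<Rightarrow> 'a \<Rightarrow> real) \<Rightarrow> (nat \<Rightarrow> 'a \<Rightarrow> 'a) \<Rightarrow> (nat \<Rightarrow> 'a) \<Rightarrow> bool"
  where "limit_pseudo_orbit Z \<rho> h x \<longleftrightarrow>
    (\<forall>n. x n \<in> Z) \<and> (\<lambda>n. \<rho> (h n (x n)) (x (Suc n))) \<longlonglongrightarrow> 0"

definition shadows ::
  "('a \<Rightarrow> 'a \<Rightarrow> real) \<Rightarrow> (nat \<Rightarrow> 'a \<Rightarrow> 'a) \<Rightarrow> real \<Rightarrow> 'a \<Rightarrow> (nat \<Rightarrow> 'a) \<Rightarrow> bool"
  where "shadows \<rho> h \<epsilon> y x \<longleftrightarrow> (\<forall>n. \<rho> (iter_seq h n y) (x n) < \<epsilon>)"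

definition limit_shadows ::
  "('a \<Rightarrow> 'a \<Rightarrow> real) \<Rightarrow> (nat \<Rightarrow> 'a \<Rightarrow> 'a) \<Rightarrow> 'a \<Rightarrow> (nat \<Rightarrow> 'a) \<Rightarrow> bool"
  where "limit_shadows \<rho> h y x \<longleftrightarrow> (\<lambda>n. \<rho> (iter_seq h n y) (x n)) \<longlonglongrightarrow> 0"

definition s_limit_shadowing ::
  "'a set \<Rightarrow> ('a \<Rightarrow> 'a \<Rightarrow> real) \<Rightarrow> (nat \<Rightarrow> 'a \<Rightarrow> 'a) \<Rightarrow> bool"
  where "s_limit_shadowing Z \<rho> h \<longleftrightarrow>
    (\<forall>\<epsilon>>0. \<exists>\<delta>>0.
      (\<forall>x. pseudo_orbit Z \<rho> h \<delta> x \<longrightarrow> (\<exists>y\<in>Z. shadows \<rho> h \<epsilon> y x)) \<and>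
      (\<forall>x. limit_pseudo_orbit Z \<rho> h x \<longrightarrow> (\<exists>y\<in>Z. limit_shadows \<rho> h y x)))"

end

theory Submission
  imports Defs
begin

text \<open>Under the maximum metric every notion involved splits into coordinates: a sequence in
  \<open>X \<times> Y\<close> is a \<open>\<delta>\<close>-pseudo-orbit, or a limit pseudo-orbit, exactly when both of its coordinate
  sequences are, and a point \<open>\<epsilon>\<close>-shadows it, or limit shadows it, exactly when this holds in both
  coordinates. For strict bounds the reason is \<open>max a b < c \<longleftrightarrow> a < c \<and> b < c\<close>; for limits it is
  that the maximum of two nonnegative sequences is a null sequence iff both of them are.

  If both factors have the property, the product therefore inherits it with the smaller of the two
  values of \<open>\<delta>\<close>, by shadowing the coordinates separately. Conversely, a pseudo-orbit of one factor is
  the projection of a pseudo-orbit of the product: the other coordinate is filled with a true orbit,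
  which is a pseudo-orbit of any precision and exists because the other phase space is nonempty.
  Projecting a shadowing point of the product back gives the result.\<close>

lemma tendsto_zero_max_iff:
  fixes a b :: "nat \<Rightarrow> real"
  assumes "\<And>n. 0 \<le> a n" and "\<And>n. 0 \<le> b n"
  shows "(\<lambda>n. max (a n) (b n)) \<longlonglongrightarrow> 0 \<longleftrightarrow> a \<longlonglongrightarrow> 0 \<and> b \<longlonglongrightarrow> 0"
proof
  assume lim: "(\<lambda>n. max (a n) (b n)) \<longlonglongrightarrow> 0"
  have "a \<longlonglongrightarrow> 0"
    by (rule tendsto_sandwich[OF _ _ tendsto_const lim]) (use assms in auto)
  moreover have "b \<longlonglongrightarrow> 0"
    by (rule tendsto_sandwich[OF _ _ tendsto_const lim]) (use assms in auto)
  ultimately show "a \<longlonglongrightarrow> 0 \<and> b \<longlonglongrightarrow> 0" ..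
next
  assume "a \<longlonglongrightarrow> 0 \<and> b \<longlonglongrightarrow> 0"
  then show "(\<lambda>n. max (a n) (b n)) \<longlonglongrightarrow> 0"
    using tendsto_max[of a 0 sequentially b 0] by simp
qed

lemma iter_seq_prod_seq:
  "iter_seq (prod_seq f g) n p = (iter_seq f n (fst p), iter_seq g n (snd p))"
  by (induction n) (auto simp: prod_seq_def)

lemma pseudo_orbit_prod_iff:
  "pseudo_orbit (X \<times> Y) (max_dist d1 d2) (prod_seq f g) \<delta> p \<longleftrightarrow>
     pseudo_orbit X d1 f \<delta> (\<lambda>n. fst (p n)) \<and> pseudo_orbit Y d2 g \<delta> (\<lambda>n. snd (p n))"
  by (auto simp: pseudo_orbit_def max_dist_def prod_seq_def mem_Times_iff)

lemma shadows_prod_iff: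
  "shadows (max_dist d1 d2) (prod_seq f g) \<epsilon> z p \<longleftrightarrow>
     shadows d1 f \<epsilon> (fst z) (\<lambda>n. fst (p n)) \<and> shadows d2 g \<epsilon> (snd z) (\<lambda>n. snd (p n))"
  by (auto simp: shadows_def max_dist_def iter_seq_prod_seq)

lemma limit_pseudo_orbit_prod_iff:
  assumes "Metric_space X d1" and "Metric_space Y d2"
  shows "limit_pseudo_orbit (X \<times> Y) (max_dist d1 d2) (prod_seq f g) p \<longleftrightarrow>
     limit_pseudo_orbit X d1 f (\<lambda>n. fst (p n)) \<and> limit_pseudo_orbit Y d2 g (\<lambda>n. snd (p n))"
  using assms[THEN Metric_space.nonneg]
  by (auto simp: limit_pseudo_orbit_def max_dist_def prod_seq_def mem_Times_iff
      tendsto_zero_max_iff)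

lemma limit_shadows_prod_iff:
  assumes "Metric_space X d1" and "Metric_space Y d2"
  shows "limit_shadows (max_dist d1 d2) (prod_seq f g) z p \<longleftrightarrow>
     limit_shadows d1 f (fst z) (\<lambda>n. fst (p n)) \<and> limit_shadows d2 g (snd z) (\<lambda>n. snd (p n))"
  using assms[THEN Metric_space.nonneg]
  by (simp add: limit_shadows_def max_dist_def iter_seq_prod_seq tendsto_zero_max_iff)

lemma pseudo_orbit_mono:
  "pseudo_orbit Z \<rho> h \<delta> x \<Longrightarrow> \<delta> \<le> \<delta>' \<Longrightarrow> pseudo_orbit Z \<rho> h \<delta>' x"
  unfolding pseudo_orbit_def by (meson less_le_trans)

lemma s_limit_shadowingE:
  assumes "s_limit_shadowing Z \<rho> h" and "0 < \<epsilon>"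
  obtains \<delta> where "\<delta> > 0"
    and "\<forall>x. pseudo_orbit Z \<rho> h \<delta> x \<longrightarrow> (\<exists>y\<in>Z. shadows \<rho> h \<epsilon> y x)"
    and "\<forall>x. limit_pseudo_orbit Z \<rho> h x \<longrightarrow> (\<exists>y\<in>Z. limit_shadows \<rho> h y x)"
  using assms(1)[unfolded s_limit_shadowing_def, rule_format, OF assms(2)]
  by (elim exE conjE)

lemma iter_seq_in:
  assumes "\<And>n. h n ` Z \<subseteq> Z" and "z \<in> Z"
  shows "iter_seq h n z \<in> Z"
  using assms by (induction n) auto

text \<open>True orbits make no error at all. Pairing one with a pseudo-orbit of the other factor
  therefore yields a pseudo-orbit of the product with the same bound.\<close>

lemma orbit_is_pseudo_orbit:
  assumes "Metric_space Z \<rho>" and "\<And>n. h n ` Z \<subseteq> Z" and "z \<in> Z" and "0 < \<delta>"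
  shows "pseudo_orbit Z \<rho> h \<delta> (\<lambda>n. iter_seq h n z)"
proof -
  have "\<rho> (iter_seq h n z) (iter_seq h n z) = 0" for n
    using assms by (simp add: Metric_space.mdist_zero iter_seq_in)
  from this[of "Suc _"] show ?thesis
    using assms by (simp add: pseudo_orbit_def iter_seq_in)
qed

lemma orbit_is_limit_pseudo_orbit:
  assumes "Metric_space Z \<rho>" and "\<And>n. h n ` Z \<subseteq> Z" and "z \<in> Z"
  shows "limit_pseudo_orbit Z \<rho> h (\<lambda>n. iter_seq h n z)"
proof -
  have "\<rho> (iter_seq h n z) (iter_seq h n z) = 0" for n
    using assms by (simp add: Metric_space.mdist_zero iter_seq_in)
  from this[of "Suc _"] show ?thesis
    using assms by (simp add: limit_pseudo_orbit_def iter_seq_in)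
qed

theorem theorem4p2:
  fixes X :: "'a set" and d1 :: "'a \<Rightarrow> 'a \<Rightarrow> real" and f :: "nat \<Rightarrow> 'a \<Rightarrow> 'a"
    and Y :: "'b set" and d2 :: "'b \<Rightarrow> 'b \<Rightarrow> real" and g :: "nat \<Rightarrow> 'b \<Rightarrow> 'b"
  assumes "nonautonomous_system X d1 f"
    and "nonautonomous_system Y d2 g"
  shows "s_limit_shadowing X d1 f \<and> s_limit_shadowing Y d2 g \<longleftrightarrow>
         s_limit_shadowing (X \<times> Y) (max_dist d1 d2) (prod_seq f g)"
proof -
  have X: "Metric_space X d1" and fX: "\<And>n. f n ` X \<subseteq> X"
    and Y: "Metric_space Y d2" and gY: "\<And>n. g n ` Y \<subseteq> Y"
    using assms by (auto simp: nonautonomous_system_def)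
  have "X \<noteq> {}" and "Y \<noteq> {}"
    using assms by (simp_all add: nonautonomous_system_def)
  \<comment> \<open>The orbits of these points fill the missing coordinate when a factor is lifted to the product.\<close>
  then obtain a b where a: "a \<in> X" and b: "b \<in> Y"
    by blast
  note split = pseudo_orbit_prod_iff shadows_prod_iff
    limit_pseudo_orbit_prod_iff[OF X Y] limit_shadows_prod_iff[OF X Y]
  show ?thesis
  proof (intro iffI conjI)
    assume "s_limit_shadowing X d1 f \<and> s_limit_shadowing Y d2 g"
    then have factors: "s_limit_shadowing X d1 f" "s_limit_shadowing Y d2 g"
      by simp_all
    show "s_limit_shadowing (X \<times> Y) (max_dist d1 d2) (prod_seq f g)"
      unfolding s_limit_shadowing_def
    proof (intro allI impI)
      fix \<epsilon> :: real assume "0 < \<epsilon>"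
      obtain \<delta>1 where \<delta>1: "\<delta>1 > 0"
        "\<forall>x. pseudo_orbit X d1 f \<delta>1 x \<longrightarrow> (\<exists>y\<in>X. shadows d1 f \<epsilon> y x)"
        "\<forall>x. limit_pseudo_orbit X d1 f x \<longrightarrow> (\<exists>y\<in>X. limit_shadows d1 f y x)"
        by (rule s_limit_shadowingE[OF factors(1) \<open>0 < \<epsilon>\<close>])
      obtain \<delta>2 where \<delta>2: "\<delta>2 > 0"
        "\<forall>x. pseudo_orbit Y d2 g \<delta>2 x \<longrightarrow> (\<exists>y\<in>Y. shadows d2 g \<epsilon> y x)"
        "\<forall>x. limit_pseudo_orbit Y d2 g x \<longrightarrow> (\<exists>y\<in>Y. limit_shadows d2 g y x)"
        by (rule s_limit_shadowingE[OF factors(2) \<open>0 < \<epsilon>\<close>])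
      show "\<exists>\<delta>>0.
        (\<forall>p. pseudo_orbit (X \<times> Y) (max_dist d1 d2) (prod_seq f g) \<delta> p \<longrightarrow>
          (\<exists>z\<in>X \<times> Y. shadows (max_dist d1 d2) (prod_seq f g) \<epsilon> z p)) \<and>
        (\<forall>p. limit_pseudo_orbit (X \<times> Y) (max_dist d1 d2) (prod_seq f g) p \<longrightarrow>
          (\<exists>z\<in>X \<times> Y. limit_shadows (max_dist d1 d2) (prod_seq f g) z p))"
      proof (intro exI[of _ "min \<delta>1 \<delta>2"] conjI allI impI)
        show "0 < min \<delta>1 \<delta>2"
          using \<delta>1(1) \<delta>2(1) by simp
      next
        fix p assume "pseudo_orbit (X \<times> Y) (max_dist d1 d2) (prod_seq f g) (min \<delta>1 \<delta>2) p"
        then have "pseudo_orbit X d1 f \<delta>1 (\<lambda>n. fst (p n))" "pseudo_orbit Y d2 g \<delta>2 (\<lambda>n. snd (p n))"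
          by (auto simp: split intro: pseudo_orbit_mono)
        from \<delta>1(2)[rule_format, OF this(1)] \<delta>2(2)[rule_format, OF this(2)]
        obtain u v where "u \<in> X" "shadows d1 f \<epsilon> u (\<lambda>n. fst (p n))"
          "v \<in> Y" "shadows d2 g \<epsilon> v (\<lambda>n. snd (p n))"
          by (elim bexE)
        then show "\<exists>z\<in>X \<times> Y. shadows (max_dist d1 d2) (prod_seq f g) \<epsilon> z p"
          by (intro bexI[of _ "(u, v)"]) (auto simp: split)
      next
        fix p assume "limit_pseudo_orbit (X \<times> Y) (max_dist d1 d2) (prod_seq f g) p"
        then have "limit_pseudo_orbit X d1 f (\<lambda>n. fst (p n))"
          "limit_pseudo_orbit Y d2 g (\<lambda>n. snd (p n))"
          by (auto simp: split)
        from \<delta>1(3)[rule_format, OF this(1)] \<delta>2(3)[rule_format, OF this(2)]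
        obtain u v where "u \<in> X" "limit_shadows d1 f u (\<lambda>n. fst (p n))"
          "v \<in> Y" "limit_shadows d2 g v (\<lambda>n. snd (p n))"
          by (elim bexE)
        then show "\<exists>z\<in>X \<times> Y. limit_shadows (max_dist d1 d2) (prod_seq f g) z p"
          by (intro bexI[of _ "(u, v)"]) (auto simp: split)
      qed
    qed
  next
    assume product: "s_limit_shadowing (X \<times> Y) (max_dist d1 d2) (prod_seq f g)"
    show "s_limit_shadowing X d1 f"
      unfolding s_limit_shadowing_def
    proof (intro allI impI)
      fix \<epsilon> :: real assume "0 < \<epsilon>"
      obtain \<delta> where \<delta>: "\<delta> > 0"
        "\<forall>p. pseudo_orbit (X \<times> Y) (max_dist d1 d2) (prod_seq f g) \<delta> p \<longrightarrow>
          (\<exists>z\<in>X \<times> Y. shadows (max_dist d1 d2) (prod_seq f g) \<epsilon> z p)"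
        "\<forall>p. limit_pseudo_orbit (X \<times> Y) (max_dist d1 d2) (prod_seq f g) p \<longrightarrow>
          (\<exists>z\<in>X \<times> Y. limit_shadows (max_dist d1 d2) (prod_seq f g) z p)"
        by (rule s_limit_shadowingE[OF product \<open>0 < \<epsilon>\<close>])
      have "\<exists>y\<in>X. shadows d1 f \<epsilon> y x" if "pseudo_orbit X d1 f \<delta> x" for x
        using \<delta>(2)[rule_format, of "\<lambda>n. (x n, iter_seq g n b)"] that
          orbit_is_pseudo_orbit[OF Y gY b \<delta>(1)]
        by (auto simp: split)
      moreover have "\<exists>y\<in>X. limit_shadows d1 f y x" if "limit_pseudo_orbit X d1 f x" for x
        using \<delta>(3)[rule_format, of "\<lambda>n. (x n, iter_seq g n b)"] that
          orbit_is_limit_pseudo_orbit[OF Y gY b]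
        by (auto simp: split)
      ultimately show "\<exists>\<delta>>0.
          (\<forall>x. pseudo_orbit X d1 f \<delta> x \<longrightarrow> (\<exists>y\<in>X. shadows d1 f \<epsilon> y x)) \<and>
          (\<forall>x. limit_pseudo_orbit X d1 f x \<longrightarrow> (\<exists>y\<in>X. limit_shadows d1 f y x))"
        using \<delta>(1) by blast
    qed
    show "s_limit_shadowing Y d2 g"
      unfolding s_limit_shadowing_def
    proof (intro allI impI)
      fix \<epsilon> :: real assume "0 < \<epsilon>"
      obtain \<delta> where \<delta>: "\<delta> > 0"
        "\<forall>p. pseudo_orbit (X \<times> Y) (max_dist d1 d2) (prod_seq f g) \<delta> p \<longrightarrow>
          (\<exists>z\<in>X \<times> Y. shadows (max_dist d1 d2) (prod_seq f g) \<epsilon> z p)"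
        "\<forall>p. limit_pseudo_orbit (X \<times> Y) (max_dist d1 d2) (prod_seq f g) p \<longrightarrow>
          (\<exists>z\<in>X \<times> Y. limit_shadows (max_dist d1 d2) (prod_seq f g) z p)"
        by (rule s_limit_shadowingE[OF product \<open>0 < \<epsilon>\<close>])
      have "\<exists>y\<in>Y. shadows d2 g \<epsilon> y x" if "pseudo_orbit Y d2 g \<delta> x" for x
        using \<delta>(2)[rule_format, of "\<lambda>n. (iter_seq f n a, x n)"] that
          orbit_is_pseudo_orbit[OF X fX a \<delta>(1)]
        by (auto simp: split)
      moreover have "\<exists>y\<in>Y. limit_shadows d2 g y x" if "limit_pseudo_orbit Y d2 g x" for x
        using \<delta>(3)[rule_format, of "\<lambda>n. (iter_seq f n a, x n)"] that
          orbit_is_limit_pseudo_orbit[OF X fX a]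
        by (auto simp: split)
      ultimately show "\<exists>\<delta>>0.
          (\<forall>x. pseudo_orbit Y d2 g \<delta> x \<longrightarrow> (\<exists>y\<in>Y. shadows d2 g \<epsilon> y x)) \<and>
          (\<forall>x. limit_pseudo_orbit Y d2 g x \<longrightarrow> (\<exists>y\<in>Y. limit_shadows d2 g y x))"
        using \<delta>(1) by blast
    qed
  qed
qed

end
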